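(* Let $E\subset\mathbb{R}^n$ be open, let $L$ be a continuous vector field on $E$, let $q:E\to\mathbb{R}$ be continuous, and let $\eta\in C^1(E)$ be a function with no zeros in $E$ satisfying $(L+q)\eta=0$ on $E$. Then on $C^1(E)$ the operator equality $$\eta L\eta^{-1}=L+q$$ holds, i.e. $\eta\, L(\eta^{-1}\psi)=L\psi+q\psi$ for every $\psi\in C^1(E)$.
   Context: $C^k(E)$ is the set of real-valued functions on $E$ that are $k$ times continuously differentiable. A continuous vector field $L=\sum_{k=1}^n a_k\,\partial/\partial x_k$ ($a_k\in C^0(E)$) is regarded as the operator $C^1(E)\to C^0(E)$, $\psi\mapsto L\psi=\sum_k a_k\,\partial\psi/\partial x_k$ (Lie derivative). The operator $L+q:C^1(E)\to C^0(E)$ is $(L+q)\psi=L\psi+q\psi$. A scalar function appearing as a factor in an operator product denotes the operator of multiplication by that function, and products are compositions; $\eta^{-1}=1/\eta$. *)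

theory Defs
  imports "HOL-Analysis.Analysis"
begin

text \<open>
  Functions on an open set \<open>E\<close> are represented by total functions on \<open>real^'n\<close>; only their values
  on \<open>E\<close> are meaningful. As \<open>E\<close> is open, these values determine the partial derivatives at the
  points of \<open>E\<close>.
\<close>

definition partial_deriv :: "'n::finite \<Rightarrow> (real^'n \<Rightarrow> real) \<Rightarrow> real^'n \<Rightarrow> real" where
  "partial_deriv k f x = deriv (\<lambda>t. f (x + t *\<^sub>R axis k 1)) 0"

text \<open>\<open>C_diff k E\<close> is \<open>C\<^sup>k(E)\<close>; it is intended for open \<open>E\<close> only.\<close>

primrec C_diff :: "nat \<Rightarrow> (real^'n::finite) set \<Rightarrow> (real^'n \<Rightarrow> real) set" where
  "C_diff 0 E = {f. continuous_on E f}"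
| "C_diff (Suc k) E = {f. f differentiable_on E \<and> (\<forall>i. partial_deriv i f \<in> C_diff k E)}"

definition lie_op :: "(real^'n::finite \<Rightarrow> real^'n) \<Rightarrow> (real^'n \<Rightarrow> real) \<Rightarrow> real^'n \<Rightarrow> real" where
  "lie_op a \<psi> x = (\<Sum>k\<in>UNIV. a x $ k * partial_deriv k \<psi> x)"

definition mult_op :: "(real^'n::finite \<Rightarrow> real) \<Rightarrow> (real^'n \<Rightarrow> real) \<Rightarrow> real^'n \<Rightarrow> real" where
  "mult_op g \<psi> x = g x * \<psi> x"

definition lie_plus_op ::
  "(real^'n::finite \<Rightarrow> real^'n) \<Rightarrow> (real^'n \<Rightarrow> real) \<Rightarrow> (real^'n \<Rightarrow> real) \<Rightarrow> real^'n \<Rightarrow> real" where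
  "lie_plus_op a q \<psi> x = lie_op a \<psi> x + mult_op q \<psi> x"

end

theory Submission
  imports Defs
begin

text \<open>
  Conjugation by \<open>\<eta>\<close> turns a derivation into a derivation plus a potential. By the quotient rule,
  \<open>\<eta> L (\<psi> / \<eta>) = L \<psi> - (\<psi> / \<eta>) L \<eta>\<close>, and the hypothesis on \<open>\<eta>\<close> says \<open>L \<eta> = - q \<eta>\<close>, so the
  correction \<open>- (\<psi> / \<eta>) L \<eta>\<close> equals \<open>q \<psi>\<close>. The quotient rule is needed for each partial derivative
  (\<open>partial_deriv_divide\<close>); the same formula shows that the partial derivatives of \<open>\<psi> / \<eta>\<close> are
  continuous, hence that \<open>L\<close> may be applied to \<open>\<psi> / \<eta>\<close> (\<open>C_diff_1_divide\<close>).
\<close>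

lemma C_diff_1_iff:
  "f \<in> C_diff 1 E \<longleftrightarrow> f differentiable_on E \<and> (\<forall>k. continuous_on E (partial_deriv k f))"
  by simp

lemma C_diff_1_imp_differentiable:
  assumes "open E" "f \<in> C_diff 1 E" "x \<in> E"
  shows "f differentiable (at x)"
  using assms by (simp add: differentiable_on_eq_differentiable_at)

text \<open>
  The definition of a partial derivative through \<open>deriv\<close> yields an arbitrary value where the
  one-variable restriction is not differentiable; total differentiability excludes this by the
  chain rule along the coordinate line.
\<close>

lemma has_partial_deriv:
  fixes f :: "real^'n::finite \<Rightarrow> real"
  assumes "f differentiable (at x)"
  shows "((\<lambda>t. f (x + t *\<^sub>R axis k 1)) has_field_derivative partial_deriv k f x) (at 0)"
proof -
  have "(\<lambda>t::real. x + t *\<^sub>R axis k 1) differentiable (at 0)"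
    by simp
  moreover have "f differentiable (at (x + (0::real) *\<^sub>R axis k 1))"
    using assms by simp
  ultimately have "(f \<circ> (\<lambda>t. x + t *\<^sub>R axis k 1)) differentiable (at 0)"
    by (rule differentiable_chain_at)
  then have "(\<lambda>t. f (x + t *\<^sub>R axis k 1)) field_differentiable (at 0)"
    by (simp add: o_def field_differentiable_def real_differentiable_def)
  then show ?thesis
    unfolding partial_deriv_def by (rule field_differentiable_derivI)
qed

lemma partial_deriv_divide:
  fixes f g :: "real^'n::finite \<Rightarrow> real"
  assumes "f differentiable (at x)" "g differentiable (at x)" "g x \<noteq> 0"
  shows "partial_deriv k (\<lambda>y. f y / g y) x =
           (partial_deriv k f x * g x - f x * partial_deriv k g x) / (g x * g x)"
  using DERIV_divide[OF has_partial_deriv[OF assms(1)] has_partial_deriv[OF assms(2)], of k k] assms(3)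
  by (simp add: partial_deriv_def DERIV_imp_deriv)

lemma C_diff_1_divide:
  fixes f g :: "real^'n::finite \<Rightarrow> real"
  assumes "open E" and f: "f \<in> C_diff 1 E" and g: "g \<in> C_diff 1 E"
    and nz: "\<And>x. x \<in> E \<Longrightarrow> g x \<noteq> 0"
  shows "(\<lambda>x. f x / g x) \<in> C_diff 1 E"
  unfolding C_diff_1_iff
proof (intro conjI allI)
  note df = C_diff_1_imp_differentiable[OF \<open>open E\<close> f]
    and dg = C_diff_1_imp_differentiable[OF \<open>open E\<close> g]
  show "(\<lambda>x. f x / g x) differentiable_on E"
    using df dg nz \<open>open E\<close> by (simp add: differentiable_on_eq_differentiable_at)
  fix k
  have "continuous_on E f" "continuous_on E g"
    using f g by (simp_all add: differentiable_imp_continuous_on)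
  then have "continuous_on E (\<lambda>x. (partial_deriv k f x * g x - f x * partial_deriv k g x) / (g x * g x))"
    using f g nz unfolding C_diff_1_iff by (intro continuous_intros) auto
  then show "continuous_on E (partial_deriv k (\<lambda>x. f x / g x))"
    using partial_deriv_divide[OF df dg nz] by (simp cong: continuous_on_cong)
qed

lemma lie_op_divide:
  fixes f g :: "real^'n::finite \<Rightarrow> real"
  assumes "f differentiable (at x)" "g differentiable (at x)" "g x \<noteq> 0"
  shows "lie_op a (\<lambda>y. f y / g y) x = (lie_op a f x * g x - f x * lie_op a g x) / (g x * g x)"
  unfolding lie_op_def partial_deriv_divide[OF assms]
  by (simp add: sum_distrib_left sum_distrib_right sum_subtractf[symmetric]
      sum_divide_distrib algebra_simps)

theorem theorem1:
  fixes E :: "(real^'n::finite) set"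
    and a :: "real^'n \<Rightarrow> real^'n"
    and q \<eta> :: "real^'n \<Rightarrow> real"
  assumes "open E"
    and "\<And>k. (\<lambda>x. a x $ k) \<in> C_diff 0 E"
    and "continuous_on E q"
    and "\<eta> \<in> C_diff 1 E"
    and "\<forall>x\<in>E. \<eta> x \<noteq> 0"
    and "\<forall>x\<in>E. lie_plus_op a q \<eta> x = 0"
  shows "\<forall>\<psi>\<in>C_diff 1 E.
           mult_op (\<lambda>x. 1 / \<eta> x) \<psi> \<in> C_diff 1 E \<and>
           (\<forall>x\<in>E. (mult_op \<eta> \<circ> lie_op a \<circ> mult_op (\<lambda>x. 1 / \<eta> x)) \<psi> x = lie_plus_op a q \<psi> x)"
proof (intro ballI conjI)
  fix \<psi> :: "real^'n \<Rightarrow> real"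
  assume \<psi>: "\<psi> \<in> C_diff 1 E"
  have quotient: "mult_op (\<lambda>x. 1 / \<eta> x) \<psi> = (\<lambda>x. \<psi> x / \<eta> x)"
    by (simp add: fun_eq_iff mult_op_def)
  show "mult_op (\<lambda>x. 1 / \<eta> x) \<psi> \<in> C_diff 1 E"
    unfolding quotient using C_diff_1_divide[OF assms(1) \<psi> assms(4)] assms(5) by blast
  fix x assume x: "x \<in> E"
  have nz: "\<eta> x \<noteq> 0"
    using assms(5) x by blast
  have L\<eta>: "lie_op a \<eta> x = - (q x * \<eta> x)"
    using assms(6) x by (auto simp: lie_plus_op_def mult_op_def)
  have "(mult_op \<eta> \<circ> lie_op a \<circ> mult_op (\<lambda>x. 1 / \<eta> x)) \<psi> x = \<eta> x * lie_op a (\<lambda>y. \<psi> y / \<eta> y) x"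
    by (simp add: quotient mult_op_def[of \<eta>])
  also have "\<dots> = \<eta> x * ((lie_op a \<psi> x * \<eta> x - \<psi> x * lie_op a \<eta> x) / (\<eta> x * \<eta> x))"
    by (simp only: lie_op_divide[OF C_diff_1_imp_differentiable[OF assms(1) \<psi> x]
          C_diff_1_imp_differentiable[OF assms(1) assms(4) x] nz])
  also have "\<dots> = lie_op a \<psi> x + q x * \<psi> x"
    unfolding L\<eta> using nz by (simp add: field_simps)
  finally show "(mult_op \<eta> \<circ> lie_op a \<circ> mult_op (\<lambda>x. 1 / \<eta> x)) \<psi> x = lie_plus_op a q \<psi> x"
    by (simp add: lie_plus_op_def mult_op_def)
qed

end
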